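(* Let $R$ be the amplification map of MIISO2, MIISO3, or MIISO4 with cutoff $\omega_c>0$ and $\omega_0=r\,\omega_c$, $r\in(0,1)$. If $0\le\omega\le\omega_0$, then $|R(i\omega)|=1$.
   Context: Padé approximants. $[m/n]=P_{m,n}/Q_{m,n}$ is the Padé approximant of $e^z$: $\deg P_{m,n}=m$, $\deg Q_{m,n}=n$, $Q_{m,n}(0)=1$, $[m/n](z)-e^z=O(z^{m+n+1})$. In particular $[1/1](z)=\frac{1+z/2}{1-z/2}$ and $[2/2](z)=\frac{1+z/2+z^2/12}{1-z/2+z^2/12}$; $[0/N]=1/Q_N$ with $Q_N(z)=\sum_{j=0}^N(-z)^j/j!$. Repaired dissipative map. For $N\in\{3,4\}$ let $\mathcal{W}_N=\{\mathrm{Re}(z)\le0,\ |Q_N(z)|<1\}$, $R_{\mathrm{raw}}=[0/N]$, $R_{\mathrm{fix}}=[1/(N-1)]$, $\delta=0.10$, $\omega_*=\sqrt3$ ($N=3$) or $\sqrt8$ ($N=4$); for $0<|y|<\omega_*$ let $x_b(y)<0$ be the unique negative root $x$ of $|Q_N(x+iy)|=1$. The weight $\theta_{\mathrm{wedge}}(z)\in[0,1]$ equals $1$ on $\mathcal{W}_N$ and at the origin, decreases linearly to $0$ across a transition pad around $\mathcal{W}_N$ with outer edge $\mathrm{Re}(z)=(1+\delta)x_b(\mathrm{Im}(z))$ or $|\mathrm{Im}(z)|=(1+\delta)\omega_*$, and is $0$ outside. With $\theta=\theta_{\mathrm{wedge}}(z)$, $R_D(z)=|R_{\mathrm{fix}}(z)|^{\theta}|R_{\mathrm{raw}}(z)|^{1-\theta}\exp(i[(1-\theta)\arg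 R_{\mathrm{raw}}(z)+\theta\arg R_{\mathrm{fix}}(z)])$, continuous branches of $\arg$ vanishing at $0$. Amplification map. Parents: MIISO2: $R_C=[1/1]$, $R_D=[0/2]$; MIISO3: $R_C=[2/2]$, $R_D$ the repaired map with $N=3$; MIISO4: $R_C=[2/2]$, $R_D$ the repaired map with $N=4$. Fix $r\in(0,1)$ and an integer $s>1$ (defaults $r=0.99$, $s=4$), $\omega_0=r\omega_c$, and the taper $\theta(\omega)=0$ for $\omega\le\omega_0$, $\bigl(\frac{\omega-\omega_0}{\omega_c-\omega_0}\bigr)^s$ for $\omega_0<\omega<\omega_c$, $1$ for $\omega\ge\omega_c$. Then $R(z)=|R_D(z)|^{\theta(|z|)}|R_C(z)|^{1-\theta(|z|)}\exp(i[(1-\theta(|z|))\arg R_C(z)+\theta(|z|)\arg R_D(z)])$, with $R=R_C$ where $\theta=0$ and $R=R_D$ where $\theta=1$. *)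

theory Defs
  imports
    "HOL-Analysis.Analysis"
    "HOL-Computational_Algebra.Polynomial"
    "HOL-Library.Landau_Symbols"
begin

definition is_pade_exp :: "nat \<Rightarrow> nat \<Rightarrow> complex poly \<Rightarrow> complex poly \<Rightarrow> bool" where
  "is_pade_exp m n P Q \<longleftrightarrow>
     degree P = m \<and> degree Q = n \<and> poly Q 0 = 1 \<and>
     (\<lambda>z. poly P z / poly Q z - exp z) \<in> O[at 0](\<lambda>z. z ^ (m + n + 1))"

definition pade :: "nat \<Rightarrow> nat \<Rightarrow> complex \<Rightarrow> complex" where
  "pade m n = (THE f. \<exists>P Q. is_pade_exp m n P Q \<and> f = (\<lambda>z. poly P z / poly Q z))"

text \<open>
  The continuous branch of the argument of \<open>f\<close> that vanishes at \<open>0\<close>, obtained by continuation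
  along the segment from \<open>0\<close> to \<open>z\<close>. The maps below have zeros and poles, so there is no
  continuous branch on the whole plane minus these points; continuation along segments gives the
  branch on the star-shaped domain of all \<open>z\<close> such that the segment avoids them. A pole is
  excluded by the condition \<open>f (t * z) \<noteq> 0\<close> because division by zero yields zero.
\<close>

definition arg_branch :: "(complex \<Rightarrow> complex) \<Rightarrow> complex \<Rightarrow> real" where
  "arg_branch f z = (THE \<phi>. \<exists>a :: real \<Rightarrow> real.
     continuous_on {0..1} a \<and> a 0 = 0 \<and> a 1 = \<phi> \<and>
     (\<forall>t\<in>{0..1}. f (of_real t * z) \<noteq> 0 \<and>
        f (of_real t * z) = of_real (cmod (f (of_real t * z))) * cis (a t)))"

text \<open>
  The first two cases agree with the general formula wherever the latter makes sense; they are
  separate because \<open>0 powr 0 = 0\<close>.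
\<close>

definition geometric_blend ::
  "real \<Rightarrow> (complex \<Rightarrow> complex) \<Rightarrow> (complex \<Rightarrow> complex) \<Rightarrow> complex \<Rightarrow> complex" where
  "geometric_blend \<theta> f g z =
     (if \<theta> = 0 then f z
      else if \<theta> = 1 then g z
      else of_real (cmod (g z) powr \<theta> * cmod (f z) powr (1 - \<theta>)) *
           exp (\<i> * of_real ((1 - \<theta>) * arg_branch f z + \<theta> * arg_branch g z)))"

definition Q_den :: "nat \<Rightarrow> complex \<Rightarrow> complex" where
  "Q_den N z = (\<Sum>j\<le>N. (- z) ^ j / fact j)"

definition wedge :: "nat \<Rightarrow> complex set" where
  "wedge N = {z. Re z \<le> 0 \<and> cmod (Q_den N z) < 1}"

text \<open>Only \<open>N = 3\<close> and \<open>N = 4\<close> are used.\<close>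

definition omega_star :: "nat \<Rightarrow> real" where
  "omega_star N = (if N = 3 then sqrt 3 else sqrt 8)"

text \<open>Meaningful for \<open>0 < \<bar>y\<bar> < omega_star N\<close> only.\<close>

definition x_b :: "nat \<Rightarrow> real \<Rightarrow> real" where
  "x_b N y = (THE x. x < 0 \<and> cmod (Q_den N (Complex x y)) = 1)"

definition pad_width :: real where
  "pad_width = 1 / 10"

text \<open>
  For \<open>0 < \<bar>Im z\<bar> < omega_star N\<close> the weight is linear in \<open>Re z\<close> between the
  edge \<open>x_b\<close> of the wedge and the outer edge. For \<open>omega_star N \<le> \<bar>Im z\<bar>\<close>, where \<open>x_b\<close> is not
  defined, it is linear in \<open>\<bar>Im z\<bar>\<close>, with value \<open>1\<close> at the tips \<open>\<plusminus>\<i> * omega_star N\<close> of the wedge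
  and value \<open>0\<close> at the outer edge; how far these caps of the pad extend into \<open>Re z < 0\<close> is left
  open, as are the values for \<open>Re z > 0\<close>, where the wedge has no outer edge. On the imaginary axis
  the weight is uniquely determined.
\<close>

definition wedge_weight :: "nat \<Rightarrow> (complex \<Rightarrow> real) \<Rightarrow> bool" where
  "wedge_weight N w \<longleftrightarrow>
     (\<forall>z. 0 \<le> w z \<and> w z \<le> 1) \<and>
     (\<forall>z \<in> wedge N \<union> {0}. w z = 1) \<and>
     (\<forall>x y. 0 < \<bar>y\<bar> \<and> \<bar>y\<bar> < omega_star N \<and> (1 + pad_width) * x_b N y \<le> x \<and> x \<le> x_b N y \<longrightarrow>
        w (Complex x y) = ((1 + pad_width) * x_b N y - x) / (pad_width * x_b N y)) \<and>
     w (Complex 0 (omega_star N)) = 1 \<and> w (Complex 0 (- omega_star N)) = 1 \<and>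
     (\<forall>x y. x \<le> 0 \<and> omega_star N \<le> \<bar>y\<bar> \<and> \<bar>y\<bar> \<le> (1 + pad_width) * omega_star N \<longrightarrow>
        w (Complex x y) = ((1 + pad_width) * omega_star N - \<bar>y\<bar>) / (pad_width * omega_star N) *
          w (Complex x (sgn y * omega_star N))) \<and>
     (\<forall>x y. 0 < \<bar>y\<bar> \<and> \<bar>y\<bar> < omega_star N \<and> x < (1 + pad_width) * x_b N y \<longrightarrow>
        w (Complex x y) = 0) \<and>
     (\<forall>x<0. w (Complex x 0) = 0) \<and>
     (\<forall>x y. (1 + pad_width) * omega_star N < \<bar>y\<bar> \<longrightarrow> w (Complex x y) = 0)"

definition repaired_map :: "nat \<Rightarrow> (complex \<Rightarrow> real) \<Rightarrow> complex \<Rightarrow> complex" where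
  "repaired_map N w z = geometric_blend (w z) (pade 0 N) (pade 1 (N - 1)) z"

datatype miiso = MIISO2 | MIISO3 | MIISO4

fun conservative_parent :: "miiso \<Rightarrow> complex \<Rightarrow> complex" where
  "conservative_parent MIISO2 = pade 1 1"
| "conservative_parent MIISO3 = pade 2 2"
| "conservative_parent MIISO4 = pade 2 2"

fun is_dissipative_parent :: "miiso \<Rightarrow> (complex \<Rightarrow> complex) \<Rightarrow> bool" where
  "is_dissipative_parent MIISO2 R\<^sub>D \<longleftrightarrow> R\<^sub>D = pade 0 2"
| "is_dissipative_parent MIISO3 R\<^sub>D \<longleftrightarrow> (\<exists>w. wedge_weight 3 w \<and> R\<^sub>D = repaired_map 3 w)"
| "is_dissipative_parent MIISO4 R\<^sub>D \<longleftrightarrow> (\<exists>w. wedge_weight 4 w \<and> R\<^sub>D = repaired_map 4 w)"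

definition taper :: "real \<Rightarrow> nat \<Rightarrow> real \<Rightarrow> real \<Rightarrow> real" where
  "taper r s \<omega>\<^sub>c \<omega> =
     (let \<omega>\<^sub>0 = r * \<omega>\<^sub>c in
      if \<omega> \<le> \<omega>\<^sub>0 then 0
      else if \<omega> < \<omega>\<^sub>c then ((\<omega> - \<omega>\<^sub>0) / (\<omega>\<^sub>c - \<omega>\<^sub>0)) ^ s
      else 1)"

definition is_amplification_map ::
  "miiso \<Rightarrow> real \<Rightarrow> nat \<Rightarrow> real \<Rightarrow> (complex \<Rightarrow> complex) \<Rightarrow> bool" where
  "is_amplification_map M r s \<omega>\<^sub>c R \<longleftrightarrow>
     (\<exists>R\<^sub>D. is_dissipative_parent M R\<^sub>D \<and>
        R = (\<lambda>z. geometric_blend (taper r s \<omega>\<^sub>c (cmod z)) (conservative_parent M) R\<^sub>D z))"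

end

theory Submission
  imports Defs
begin

text \<open>
  Below the cutoff the taper vanishes, so the map is the diagonal approximant \<open>[1/1]\<close> or \<open>[2/2]\<close>.
  These have the form \<open>P(z) / P(-z)\<close> with a real polynomial \<open>P\<close>, so that numerator and denominator
  are complex conjugates of each other on the imaginary axis. To identify \<^const>\<open>pade\<close> with an
  explicit quotient \<open>P / Q\<close>, note that any competitor \<open>P' / Q'\<close> makes \<open>P' Q - P Q'\<close>, of degree at
  most \<open>m + n\<close>, vanish to order \<open>m + n + 1\<close>, hence be zero. A Bezout identity for \<open>P\<close> and \<open>Q\<close>
  then shows that \<open>Q\<close> divides \<open>Q'\<close>, and the degree and normalization conditions force \<open>Q' = Q\<close>
  and \<open>P' = P\<close>.
\<close>

lemma tendsto_poly_at: "(poly p \<longlongrightarrow> poly p a) (at a)"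
  for p :: "'a :: real_normed_field poly"
  by (intro isContD poly_isCont)

lemma bigo_1_if_tendsto: "f \<in> O[F](\<lambda>_. 1)" if "(f \<longlongrightarrow> c) F"
  for f :: "'a \<Rightarrow> 'b :: real_normed_field"
  using that by (intro bigoI_tendsto[of _ _ c]) simp_all

text \<open>Dividing a nonzero \<open>p\<close> by z^k, with k the order of its zero at 0, leaves a
  factor \<open>q\<close> with q(0) nonzero. Since k <= deg p < n, this \<open>q\<close> would be
  O(z^(n-k)) and hence tend to 0.\<close>

lemma poly_eq_0_if_bigo:
  fixes p :: "complex poly"
  assumes "poly p \<in> O[at 0](\<lambda>z. z ^ n)" and "degree p < n"
  shows "p = 0"
proof (rule ccontr)
  assume "p \<noteq> 0"
  define k where "k = order 0 p"
  obtain q where q: "p = [:0, 1:] ^ k * q" and "\<not> [:0, 1:] dvd q"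
    using order_decomp[OF \<open>p \<noteq> 0\<close>, of 0] by (auto simp: k_def)
  hence q0: "poly q 0 \<noteq> 0"
    by (simp add: dvd_iff_poly_eq_0)
  have "k < n"
    using order_degree[OF \<open>p \<noteq> 0\<close>, of 0] assms(2) by (simp add: k_def)
  have nz: "eventually (\<lambda>z::complex. z ^ k \<noteq> 0) (at 0)"
    by (rule eventually_mono[OF eventually_neq_at_within[of 0]]) simp
  have "poly p = (\<lambda>z. z ^ k * poly q z)"
    by (simp add: q fun_eq_iff)
  hence "(\<lambda>z. z ^ k * poly q z) \<in> O[at 0](\<lambda>z. z ^ k * z ^ (n - k))"
    using assms(1) \<open>k < n\<close> by (simp flip: power_add)
  hence "poly q \<in> O[at 0](\<lambda>z. z ^ (n - k))"
    by (subst (asm) landau_o.big.mult_cancel_left[OF bigtheta_refl nz])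
  moreover have "((\<lambda>z::complex. z ^ (n - k)) \<longlongrightarrow> 0) (at 0)"
    using \<open>k < n\<close> by (auto intro!: tendsto_eq_intros)
  hence "(\<lambda>z::complex. z ^ (n - k)) \<in> o[at 0](\<lambda>_. 1)"
    by (intro smalloI_tendsto) simp_all
  ultimately have "poly q \<in> o[at 0](\<lambda>_. 1)"
    by (rule landau_o.big_small_trans)
  hence "(poly q \<longlongrightarrow> 0) (at 0)"
    using smalloD_tendsto by fastforce
  thus False
    using q0 tendsto_unique[OF _ tendsto_poly_at, of 0 q] trivial_limit_at by metis
qed

lemma is_pade_exp_cross_eq:
  assumes "is_pade_exp m n P Q" and "is_pade_exp m n P' Q'"
  shows "P' * Q = P * Q'"
proof -
  define D where "D = P' * Q - P * Q'"
  have Q: "poly Q 0 = 1" "poly Q' 0 = 1"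
    using assms by (auto simp: is_pade_exp_def)
  have bnd: "poly q \<in> O[at 0](\<lambda>_. 1)" for q :: "complex poly"
    using tendsto_poly_at by (rule bigo_1_if_tendsto)
  have nz: "eventually (\<lambda>z. poly q z \<noteq> 0) (at 0)" if "poly q 0 = 1" for q :: "complex poly"
    using tendsto_imp_eventually_ne[OF tendsto_poly_at, of q 0] that by simp
  have "(\<lambda>z. (poly P' z / poly Q' z - exp z) - (poly P z / poly Q z - exp z))
          \<in> O[at 0](\<lambda>z. z ^ (m + n + 1))"
    by (rule sum_in_bigo(2)) (use assms in \<open>simp_all only: is_pade_exp_def\<close>)
  \<comment> \<open>The exponentials cancel in the difference; the factor \<open>Q * Q'\<close> is
    bounded near 0, so it clears both denominators without lowering the order.\<close>
  hence "(\<lambda>z. poly (Q * Q') z * ((poly P' z / poly Q' z - exp z) - (poly P z / poly Q z - exp z)))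
          \<in> O[at 0](\<lambda>z. 1 * z ^ (m + n + 1))"
    by (rule landau_o.big.mult[OF bnd])
  moreover have "eventually (\<lambda>z. poly (Q * Q') z *
      ((poly P' z / poly Q' z - exp z) - (poly P z / poly Q z - exp z)) = poly D z) (at 0)"
    using nz[OF Q(1)] nz[OF Q(2)]
    by eventually_elim (simp add: D_def field_simps)
  ultimately have "poly D \<in> O[at 0](\<lambda>z. z ^ (m + n + 1))"
    unfolding mult_1 by (rule landau_o.big.in_cong[THEN iffD1, rotated])
  moreover have "degree D < m + n + 1"
    using assms degree_mult_le[of P' Q] degree_mult_le[of P Q']
    unfolding D_def is_pade_exp_def
    by (intro le_less_trans[OF degree_diff_le[of _ "m + n"]]) auto
  ultimately show ?thesis
    using poly_eq_0_if_bigo[of D] by (simp only: D_def right_minus_eq)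
qed

lemma pade_eqI:
  assumes "is_pade_exp m n P Q" and bezout: "A * P + B * Q = 1"
  shows "pade m n = (\<lambda>z. poly P z / poly Q z)"
  unfolding pade_def
proof (rule the_equality)
  fix f assume "\<exists>P Q. is_pade_exp m n P Q \<and> f = (\<lambda>z. poly P z / poly Q z)"
  then obtain P' Q' where PQ': "is_pade_exp m n P' Q'" and f: "f = (\<lambda>z. poly P' z / poly Q' z)"
    by blast
  have Q: "poly Q 0 = 1" "poly Q' 0 = 1" "degree Q' = degree Q"
    using assms(1) PQ' by (auto simp: is_pade_exp_def)
  have cross: "P' * Q = P * Q'"
    using is_pade_exp_cross_eq[OF assms(1) PQ'] .
  have "Q' = (A * P + B * Q) * Q'"
    by (simp add: bezout)
  \<comment> \<open>Trading \<open>P * Q'\<close> for \<open>P' * Q\<close> puts the factor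
    \<open>Q\<close> into both summands.\<close>
  also have "\<dots> = A * (P' * Q) + B * Q * Q'"
    unfolding cross by (simp add: algebra_simps)
  finally obtain c where c: "Q' = Q * c"
    by (metis dvd_add dvd_def dvd_mult dvd_mult2 dvd_triv_right)
  have "Q \<noteq> 0" "c \<noteq> 0"
    using Q c by auto
  hence "degree c = 0"
    using Q(3) c by (simp add: degree_mult_eq)
  then obtain a where "c = [:a:]"
    by (rule degree_eq_zeroE)
  hence "c = 1"
    using Q(1,2) c by (simp add: one_pCons)
  hence "Q' = Q" using c by simp
  thus "f = (\<lambda>z. poly P z / poly Q z)"
    using cross f \<open>Q \<noteq> 0\<close> by simp
qed (use assms(1) in blast)

text \<open>Reduces the order condition to a polynomial identity with an explicit witness
  \<open>H\<close>. With T the Taylor polynomial of exp of degree k, P/Q - T equals z^(k+1) H/Q near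
  0, where H/Q is bounded, and exp - T is a Taylor remainder of the same order.\<close>

lemma bigo_quotient_minus_exp:
  fixes P Q H :: "complex poly"
  assumes "poly Q 0 \<noteq> 0"
    and "\<And>z. poly P z - poly Q z * (\<Sum>i\<le>k. z ^ i / fact i) = z ^ (k + 1) * poly H z"
  shows "(\<lambda>z. poly P z / poly Q z - exp z) \<in> O[at 0](\<lambda>z. z ^ (k + 1))"
proof -
  define T where "T z = (\<Sum>i\<le>k. z ^ i / fact i :: complex)" for z
  have "((\<lambda>z. poly H z / poly Q z) \<longlongrightarrow> poly H 0 / poly Q 0) (at 0)"
    using assms(1) by (intro tendsto_divide tendsto_poly_at)
  hence "(\<lambda>z. z ^ (k + 1) * (poly H z / poly Q z)) \<in> O[at 0](\<lambda>z. z ^ (k + 1) * 1)"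
    by (intro landau_o.big.mult landau_o.big_refl bigo_1_if_tendsto)
  moreover have "(\<lambda>z. exp z - T z) \<in> O[at 0](\<lambda>z. z ^ (k + 1))"
  proof (rule bigoI)
    \<comment> \<open>On the unit disc the factor exp |Re z| of the remainder bound is at most
      \<open>exp 1\<close>.\<close>
    have "eventually (\<lambda>z::complex. norm z < 1) (at 0)"
      by (auto simp: eventually_at dist_norm intro!: exI[of _ 1])
    thus "eventually (\<lambda>z. norm (exp z - T z) \<le> exp 1 * norm (z ^ (k + 1))) (at 0)"
    proof eventually_elim
      case (elim z)
      have "norm (exp z - T z) \<le> exp \<bar>Re z\<bar> * norm z ^ Suc k / fact k"
        using Taylor_exp[of z k] by (simp add: T_def)
      also have "\<dots> \<le> exp \<bar>Re z\<bar> * norm z ^ Suc k / 1"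
        by (intro divide_left_mono) auto
      also have "\<dots> \<le> exp 1 * norm (z ^ (k + 1))"
        using elim abs_Re_le_cmod[of z] by (auto simp: norm_mult norm_power intro!: mult_right_mono)
      finally show ?case .
    qed
  qed
  ultimately have "(\<lambda>z. z ^ (k + 1) * (poly H z / poly Q z) - (exp z - T z))
      \<in> O[at 0](\<lambda>z. z ^ (k + 1))"
    unfolding mult_1_right by (rule sum_in_bigo(2))
  moreover have "eventually (\<lambda>z. z ^ (k + 1) * (poly H z / poly Q z) - (exp z - T z)
      = poly P z / poly Q z - exp z) (at 0)"
    using tendsto_imp_eventually_ne[OF tendsto_poly_at assms(1)]
  proof eventually_elim
    case (elim z)
    thus ?case
      using assms(2)[of z] by (simp add: T_def[symmetric] field_simps)
  qed
  ultimately show ?thesis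
    by (rule landau_o.big.in_cong[THEN iffD1, rotated])
qed

lemma pade_1_1: "pade 1 1 z = (1 + z / 2) / (1 - z / 2)"
proof -
  let ?P = "[:1, 1/2:] :: complex poly" and ?Q = "[:1, -1/2:] :: complex poly"
  have "(\<lambda>z. poly ?P z / poly ?Q z - exp z) \<in> O[at 0](\<lambda>z. z ^ (2 + 1))"
    \<comment> \<open>(1 - z/2)(1 + z + z^2/2) = 1 + z/2 - z^3/4.\<close>
    by (rule bigo_quotient_minus_exp[where H = "[:1/4:]"])
       (simp_all add: numeral_eq_Suc field_simps)
  hence "is_pade_exp 1 1 ?P ?Q"
    by (simp add: is_pade_exp_def numeral_eq_Suc)
  moreover have "[:1/2:] * ?P + [:1/2:] * ?Q = 1"
    by (simp add: one_pCons)
  ultimately have "pade 1 1 = (\<lambda>z. poly ?P z / poly ?Q z)"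
    by (rule pade_eqI)
  thus ?thesis
    by simp
qed

lemma pade_2_2: "pade 2 2 z = (1 + z / 2 + z\<^sup>2 / 12) / (1 - z / 2 + z\<^sup>2 / 12)"
proof -
  let ?P = "[:1, 1/2, 1/12:] :: complex poly" and ?Q = "[:1, -1/2, 1/12:] :: complex poly"
  have "(\<lambda>z. poly ?P z / poly ?Q z - exp z) \<in> O[at 0](\<lambda>z. z ^ (4 + 1))"
    \<comment> \<open>Multiplying \<open>?Q\<close> by the Taylor polynomial of degree 4 gives
      \<open>?P\<close> - z^5/144 + z^6/288.\<close>
    by (rule bigo_quotient_minus_exp[where H = "[:1/144, -1/288:]"])
       (simp_all add: eval_nat_numeral fact_numeral field_simps)
  hence "is_pade_exp 2 2 ?P ?Q"
    by (simp add: is_pade_exp_def)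
  \<comment> \<open>The substitution z -> -z swaps the two products, so odd powers cancel; the
    coefficient 1/12 of the cofactors removes the z^2 term.\<close>
  moreover have "[:1/2, -1/12:] * ?P + [:1/2, 1/12:] * ?Q = 1"
    by (simp add: one_pCons)
  ultimately have "pade 2 2 = (\<lambda>z. poly ?P z / poly ?Q z)"
    by (rule pade_eqI)
  thus ?thesis
    by (simp add: power2_eq_square algebra_simps)
qed

lemma norm_divide_cnj: "cmod (z / cnj z) = 1" if "z \<noteq> 0"
  using that by (simp add: norm_divide)

lemma norm_conservative_parent_imaginary:
  "cmod (conservative_parent M (\<i> * of_real y)) = 1"
proof -
  have "pade 1 1 (\<i> * of_real y) = Complex 1 (y / 2) / cnj (Complex 1 (y / 2))"
    unfolding pade_1_1 by (rule arg_cong2[where f = "(/)"]) (simp_all add: complex_eq_iff)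
  moreover have "pade 2 2 (\<i> * of_real y) =
      Complex (1 - y\<^sup>2 / 12) (y / 2) / cnj (Complex (1 - y\<^sup>2 / 12) (y / 2))"
    unfolding pade_2_2
    by (rule arg_cong2[where f = "(/)"]) (simp_all add: complex_eq_iff power2_eq_square)
  \<comment> \<open>For the second number, a vanishing imaginary part forces y = 0, and then the
    real part is 1.\<close>
  moreover have "Complex 1 (y / 2) \<noteq> 0" "Complex (1 - y\<^sup>2 / 12) (y / 2) \<noteq> 0"
    by (auto simp: complex_eq_iff)
  ultimately show ?thesis
    by (cases M) (simp_all only: conservative_parent.simps norm_divide_cnj not_False_eq_True)
qed

theorem proposition5p4:
  fixes M :: miiso and r \<omega>\<^sub>c \<omega>\<^sub>0 \<omega> :: real and s :: nat and R :: "complex \<Rightarrow> complex"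
  assumes "0 < r" and "r < 1" and "1 < s" and "0 < \<omega>\<^sub>c"
    and "\<omega>\<^sub>0 = r * \<omega>\<^sub>c"
    and "is_amplification_map M r s \<omega>\<^sub>c R"
    and "0 \<le> \<omega>" and "\<omega> \<le> \<omega>\<^sub>0"
  shows "cmod (R (\<i> * of_real \<omega>)) = 1"
proof -
  \<comment> \<open>Nonnegativity makes the modulus equal to \<omega> itself. Weight 0 selects the
    first case of \<open>geometric_blend\<close>, which returns the conservative parent
    exactly.\<close>
  have "taper r s \<omega>\<^sub>c (cmod (\<i> * of_real \<omega>)) = 0"
    using assms by (simp add: taper_def norm_mult)
  hence "R (\<i> * of_real \<omega>) = conservative_parent M (\<i> * of_real \<omega>)"
    using assms(6) by (auto simp: is_amplification_map_def geometric_blend_def)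
  thus ?thesis
    by (simp add: norm_conservative_parent_imaginary)
qed

end
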